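(* Let $p\ge2$, $\alpha\ge0$, $\theta\in\mathbb R$ and $R>0$, and let $z_0$ be the first positive zero of the Bessel function $J_0$. Then for every $u\in C_c^\infty(B^d_R\setminus\{0\})$, \[ \int_{B^d_R}\frac{|\nabla_{\mathcal L}u|^p}{d^{p(\theta-1)}}|\nabla_{\mathcal L}d|^\alpha dx\ \ge\ \int_{B^d_R}\Big|\nabla_{\mathcal L}u\cdot\frac{\nabla_{\mathcal L}d}{|\nabla_{\mathcal L}d|}\Big|^p\frac{|\nabla_{\mathcal L}d|^\alpha}{d^{p(\theta-1)}}dx \] \[ \ge\Big|\frac{Q-p\theta}{p}\Big|^p\int_{B^d_R}\frac{|u|^p}{d^{p\theta}}|\nabla_{\mathcal L}d|^{\alpha+p}dx+\frac2p\Big|\frac{Q-p\theta}{p}\Big|^{p-2}\frac{z_0^2}{R^2}\int_{B^d_R}\frac{|u|^p}{d^{p\theta-2}}|\nabla_{\mathcal L}d|^{\alpha+p}dx. \]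
   Context: Vector fields and operators. On $\mathbb R^N$ take $h\le N$ vector fields $X_i=\sum_{j=1}^N\sigma_{i,j}\partial_{x_j}$ with $\sigma_{i,j},\partial_{x_j}\sigma_{i,j}\in C(\mathbb R^N)$. Let $\sigma=(\sigma_{i,j})$ and $\nabla_{\mathcal L}=(X_1,\dots,X_h)=\sigma\nabla$. Set $\operatorname{div}_{\mathcal L}Z=\operatorname{div}(\sigma^TZ)$ and $\mathcal L_pu=\operatorname{div}_{\mathcal L}(|\nabla_{\mathcal L}u|^{p-2}\nabla_{\mathcal L}u)$. Dilations. There are dilations $\delta_\lambda(x)=(\lambda^{\beta_1}x_1,\dots,\lambda^{\beta_N}x_N)$, $\beta_j>0$, with each $X_i$ homogeneous of degree one: $X_i(f\circ\delta_\lambda)=\lambda(X_if)\circ\delta_\lambda$. Set $Q=\sum_j\beta_j$. The function $d$. $d:\mathbb R^N\to[0,\infty)$ satisfies: (i) $d\in C(\mathbb R^N)\cap C^\infty(\mathbb R^N\setminus\{0\})$; (ii) $d(x)=0$ iff $x=0$; (iii) $d(\delta_\lambda x)=\lambda d(x)$; (iv) for every $p\ge2$, $\mathcal L_p(d^{(p-Q)/(p-1)})=0$ in $\mathbb R^N\setminus\{0\}$ if $p\neq Q$, and $\mathcal L_Q(-\ln d)=0$ there if $p=Q$. Balls. $B^d_R=\{d\le R\}$. *)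

theory Defs
  imports "HOL-Analysis.Analysis"
begin

definition partial :: "'n::finite \<Rightarrow> (real^'n \<Rightarrow> real) \<Rightarrow> real^'n \<Rightarrow> real" where
  "partial j f x = deriv (\<lambda>t. f (x + t *\<^sub>R axis j 1)) 0"

definition has_partial :: "'n::finite \<Rightarrow> (real^'n \<Rightarrow> real) \<Rightarrow> real^'n \<Rightarrow> bool" where
  "has_partial j f x \<longleftrightarrow> (\<lambda>t. f (x + t *\<^sub>R axis j 1)) differentiable (at 0)"

primrec Ck :: "nat \<Rightarrow> (real^'n::finite) set \<Rightarrow> (real^'n \<Rightarrow> real) \<Rightarrow> bool" where
  "Ck 0 S f = continuous_on S f"
| "Ck (Suc k) S f = (continuous_on S f \<and> (\<forall>x\<in>S. \<forall>j. has_partial j f x)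
                      \<and> (\<forall>j. Ck k S (partial j f)))"

definition smooth_on :: "(real^'n::finite) set \<Rightarrow> (real^'n \<Rightarrow> real) \<Rightarrow> bool" where
  "smooth_on S f \<longleftrightarrow> (\<forall>k. Ck k S f)"

definition supp :: "(real^'n::finite \<Rightarrow> real) \<Rightarrow> (real^'n) set" where
  "supp f = closure {x. f x \<noteq> 0}"

text \<open>Test functions C_c^infinity(S) (extended by zero to all of R^N).\<close>
definition test_fun :: "(real^'n::finite) set \<Rightarrow> (real^'n \<Rightarrow> real) \<Rightarrow> bool" where
  "test_fun S u \<longleftrightarrow> smooth_on UNIV u \<and> compact (supp u) \<and> supp u \<subseteq> S"

definition Xf :: "('h \<Rightarrow> 'n \<Rightarrow> real^'n \<Rightarrow> real) \<Rightarrow> 'h \<Rightarrow> (real^'n::finite \<Rightarrow> real) \<Rightarrow> real^'n \<Rightarrow> real" where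
  "Xf \<sigma> i f x = (\<Sum>j\<in>UNIV. \<sigma> i j x * partial j f x)"

definition gradL :: "('h::finite \<Rightarrow> 'n \<Rightarrow> real^'n \<Rightarrow> real) \<Rightarrow> (real^'n::finite \<Rightarrow> real) \<Rightarrow> real^'n \<Rightarrow> real^'h" where
  "gradL \<sigma> f x = (\<chi> i. Xf \<sigma> i f x)"

definition dil :: "('n::finite \<Rightarrow> real) \<Rightarrow> real \<Rightarrow> real^'n \<Rightarrow> real^'n" where
  "dil \<beta> lam x = (\<chi> j. lam powr \<beta> j * x $ j)"

definition Lp_harmonic :: "('h::finite \<Rightarrow> 'n \<Rightarrow> real^'n \<Rightarrow> real) \<Rightarrow> real \<Rightarrow> (real^'n::finite \<Rightarrow> real) \<Rightarrow> (real^'n) set \<Rightarrow> bool" where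
  "Lp_harmonic \<sigma> p v S \<longleftrightarrow> (\<forall>\<phi>. test_fun S \<phi> \<longrightarrow>
      integral\<^sup>L lborel (\<lambda>x. norm (gradL \<sigma> v x) powr (p - 2) * (gradL \<sigma> v x \<bullet> gradL \<sigma> \<phi> x)) = 0)"

text \<open>Real power with the convention t^0 = 1 (also for t = 0), for t >= 0.\<close>
definition pw :: "real \<Rightarrow> real \<Rightarrow> real" where
  "pw t a = (if a = 0 then 1 else t powr a)"

definition besselJ0 :: "real \<Rightarrow> real" where
  "besselJ0 x = (\<Sum>k. (-1)^k / (fact k)^2 * (x / 2)^(2*k))"

end

(* The function v = d^kappa u with kappa = (Q - p theta)/p turns the radial derivative of u into
   (s v' - kappa v) along d = s. Expanding |kappa v - s v'|^p by Bernoulli's inequality gives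
   |kappa|^p |v|^p, an exact derivative, and (p/2) |kappa|^(p-2) |v|^(p-2) (s v')^2. The last term is
   bounded from below by the Bessel weight via a Picone identity with J(s) = J_0(z0 s/R'), which has
   no zero on (0,R') for R' > R; letting R' tend to R yields the constant z0^2/R^2.

   All of this is one pointwise inequality whose error term is s^(1-Q) times the radial derivative of
   |u|^p g(d), with g expressed through M = s J'/J. That M solves the Riccati equation
   M' = -(z0/R')^2 s - M^2/s. No polar coordinates are needed to see that the error term integrates
   to 0: q-harmonicity with q = alpha + p says that the vector field
   d^(1-Q) |grad_L d|^(q-2) grad_L d is weakly divergence free away from 0, and |u|^p g(d) is a limit of
   test functions. *)

theory Submission
  imports Defs
begin

subsection \<open>Functions of class \<open>C\<^sup>k\<close>\<close>

text \<open>Couples existence with a value, so that the rules for \<open>has_real_derivative\<close>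
  carry over directly. The term \<open>partial\<close> alone is built on \<open>deriv\<close>, which
  is unspecified where no derivative exists.\<close>

definition has_partial_derivative ::
    "'n::finite \<Rightarrow> (real^'n \<Rightarrow> real) \<Rightarrow> real^'n \<Rightarrow> real \<Rightarrow> bool" where
  "has_partial_derivative j f x D \<longleftrightarrow>
     ((\<lambda>t. f (x + t *\<^sub>R axis j 1)) has_real_derivative D) (at 0)"

lemma has_partial_derivativeD:
  assumes "has_partial_derivative j f x D"
  shows "has_partial j f x" "partial j f x = D"
  using assms
  by (auto simp: has_partial_derivative_def has_partial_def partial_def
      real_differentiable_def DERIV_imp_deriv)

lemma has_partial_imp_derivative:
  "has_partial j f x \<Longrightarrow> has_partial_derivative j f x (partial j f x)"
  by (simp add: has_partial_derivative_def has_partial_def partial_def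
      DERIV_deriv_iff_real_differentiable)

lemma has_partial_derivative_const: "has_partial_derivative j (\<lambda>x. c) x 0"
  by (simp add: has_partial_derivative_def)

lemma has_partial_derivative_add:
  assumes "has_partial_derivative j f x D" "has_partial_derivative j g x E"
  shows "has_partial_derivative j (\<lambda>x. f x + g x) x (D + E)"
  using assms unfolding has_partial_derivative_def by (rule DERIV_add)

lemma has_partial_derivative_mult:
  assumes "has_partial_derivative j f x D" "has_partial_derivative j g x E"
  shows "has_partial_derivative j (\<lambda>x. f x * g x) x (f x * E + g x * D)"
  using DERIV_mult[OF assms[unfolded has_partial_derivative_def]]
  by (simp add: has_partial_derivative_def algebra_simps)

lemma has_partial_derivative_compose:
  assumes "has_partial_derivative j f x D" "(h has_real_derivative E) (at (f x))"
  shows "has_partial_derivative j (\<lambda>x. h (f x)) x (E * D)"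
  using DERIV_chain2[of h E "\<lambda>t. f (x + t *\<^sub>R axis j 1)" 0 D] assms
  by (simp add: has_partial_derivative_def)

lemma has_partial_derivative_cong_open:
  assumes "open S" "x \<in> S" "\<And>y. y \<in> S \<Longrightarrow> f y = g y"
    and f: "has_partial_derivative j f x D"
  shows "has_partial_derivative j g x D"
proof -
  have "isCont (\<lambda>t::real. x + t *\<^sub>R axis j 1) 0" by (intro continuous_intros)
  then have "((\<lambda>t::real. x + t *\<^sub>R axis j 1) \<longlongrightarrow> x) (nhds 0)"
    using tendsto_at_iff_tendsto_nhds[of "\<lambda>t::real. x + t *\<^sub>R axis j 1" 0]
    by (simp add: continuous_at)
  then have "\<forall>\<^sub>F t in nhds 0. x + t *\<^sub>R axis j 1 \<in> S"
    using assms(1,2) topological_tendstoD by blast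
  then have "\<forall>\<^sub>F t in nhds 0. f (x + t *\<^sub>R axis j 1) = g (x + t *\<^sub>R axis j 1)"
    by eventually_elim (rule assms(3))
  from DERIV_cong_ev[OF refl this refl] show ?thesis
    using f by (simp add: has_partial_derivative_def)
qed

lemma partial_cong_open:
  assumes "open S" "x \<in> S" "\<And>y. y \<in> S \<Longrightarrow> f y = g y" "has_partial j f x"
  shows "has_partial j g x" "partial j g x = partial j f x"
  using has_partial_derivativeD
    [OF has_partial_derivative_cong_open[OF assms(1-3) has_partial_imp_derivative[OF assms(4)]]]
  by auto

lemma Ck_cong:
  assumes "open S"
  shows "Ck k S f \<Longrightarrow> (\<And>x. x \<in> S \<Longrightarrow> f x = g x) \<Longrightarrow> Ck k S g"
proof (induction k arbitrary: f g)
  case 0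
  then show ?case by (simp cong: continuous_on_cong)
next
  case (Suc k)
  have "has_partial j g x \<and> partial j g x = partial j f x" if "x \<in> S" for j x
    using partial_cong_open[OF assms that Suc.prems(2)] Suc.prems(1) that by auto
  moreover have "continuous_on S g"
    using Suc.prems by (metis Ck.simps(2) continuous_on_cong)
  moreover have "Ck k S (partial j g)" for j
    using Suc.IH[of "partial j f" "partial j g"] Suc.prems(1) calculation(1) by simp
  ultimately show ?case by simp
qed

lemma Ck_subset: "Ck k S f \<Longrightarrow> T \<subseteq> S \<Longrightarrow> Ck k T f"
  by (induction k arbitrary: f) (auto intro: continuous_on_subset)

lemma Ck_continuous_on: "Ck k S f \<Longrightarrow> continuous_on S f"
  by (cases k) auto

lemma Ck_SucD: "Ck (Suc k) S f \<Longrightarrow> Ck k S f"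
  by (induction k arbitrary: f) auto

text \<open>The candidates \<open>D j\<close> have to be right on \<open>S\<close> only. As
  \<open>S\<close> is open, \<open>Ck_cong\<close> then transfers regularity from \<open>D j\<close>
  to \<open>partial j f\<close>, whatever the two do elsewhere.\<close>

lemma Ck_SucI:
  assumes "open S" "continuous_on S f"
    and D: "\<And>j x. x \<in> S \<Longrightarrow> has_partial_derivative j f x (D j x)"
    and "\<And>j. Ck k S (D j)"
  shows "Ck (Suc k) S f"
  using assms has_partial_derivativeD[OF D] Ck_cong[OF assms(1,4)] by auto

lemma Ck_const: "open S \<Longrightarrow> Ck k S (\<lambda>x. c)"
  by (induction k arbitrary: c)
    (auto simp del: Ck.simps(2) intro!: Ck_SucI has_partial_derivative_const)

lemma Ck_add:
  assumes "open S"
  shows "Ck k S f \<Longrightarrow> Ck k S g \<Longrightarrow> Ck k S (\<lambda>x. f x + g x)"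
proof (induction k arbitrary: f g)
  case 0
  then show ?case by (auto intro: continuous_intros)
next
  case (Suc k)
  show ?case
    by (rule Ck_SucI[OF assms, where D = "\<lambda>j x. partial j f x + partial j g x"])
      (use Suc in \<open>auto intro!: continuous_intros has_partial_derivative_add has_partial_imp_derivative\<close>)
qed

lemma Ck_mult:
  assumes "open S"
  shows "Ck k S f \<Longrightarrow> Ck k S g \<Longrightarrow> Ck k S (\<lambda>x. f x * g x)"
proof (induction k arbitrary: f g)
  case 0
  then show ?case by (auto intro: continuous_intros)
next
  case (Suc k)
  have "Ck k S (\<lambda>x. f x * partial j g x + g x * partial j f x)" for j
    by (intro Ck_add[OF assms] Suc.IH Ck_SucD[OF Suc.prems(1)] Ck_SucD[OF Suc.prems(2)])
      (use Suc.prems in auto)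
  then show ?case
    by (intro Ck_SucI[OF assms, where D = "\<lambda>j x. f x * partial j g x + g x * partial j f x"])
      (use Suc in \<open>auto intro!: continuous_intros has_partial_derivative_mult has_partial_imp_derivative\<close>)
qed

lemma Ck_Un:
  assumes "open S" "open T"
  shows "Ck k S f \<Longrightarrow> Ck k T f \<Longrightarrow> Ck k (S \<union> T) f"
  by (induction k arbitrary: f) (auto intro: continuous_on_open_Un assms)

section \<open>Smooth functions: products, compositions and real powers\<close>

lemma smooth_on_const: "open S \<Longrightarrow> smooth_on S (\<lambda>x. c)"
  by (simp add: smooth_on_def Ck_const)

lemma smooth_on_add:
  "open S \<Longrightarrow> smooth_on S f \<Longrightarrow> smooth_on S g \<Longrightarrow> smooth_on S (\<lambda>x. f x + g x)"
  by (simp add: smooth_on_def Ck_add)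

lemma smooth_on_mult:
  "open S \<Longrightarrow> smooth_on S f \<Longrightarrow> smooth_on S g \<Longrightarrow> smooth_on S (\<lambda>x. f x * g x)"
  by (simp add: smooth_on_def Ck_mult)

lemma smooth_on_subset: "smooth_on S f \<Longrightarrow> T \<subseteq> S \<Longrightarrow> smooth_on T f"
  unfolding smooth_on_def using Ck_subset by blast

lemma smooth_on_continuous_on: "smooth_on S f \<Longrightarrow> continuous_on S f"
  unfolding smooth_on_def using Ck_continuous_on by blast

lemma smooth_on_partial:
  assumes "smooth_on S f"
  shows "x \<in> S \<Longrightarrow> has_partial_derivative j f x (partial j f x)"
    and "continuous_on S (partial j f)"
  using assms[unfolded smooth_on_def, rule_format, of "Suc 0"]
  by (auto intro: has_partial_imp_derivative)

text \<open>The last hypothesis replaces smoothness of \<open>h\<close>: it holds as soon as \<open>h\<close> solves a first-order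
  differential equation whose right-hand side is built smoothly from \<open>h\<close> itself.\<close>

lemma smooth_on_compose:
  assumes "open S" "smooth_on S f"
    and h: "\<And>x. x \<in> S \<Longrightarrow> (h has_real_derivative h' (f x)) (at (f x))"
    and step: "\<And>k. Ck k S (\<lambda>x. h (f x)) \<Longrightarrow> Ck k S (\<lambda>x. h' (f x))"
  shows "smooth_on S (\<lambda>x. h (f x))"
proof -
  have cont: "continuous_on S (\<lambda>x. h (f x))"
  proof (rule continuous_on_compose2[of "f ` S" h])
    show "continuous_on (f ` S) h"
      using h by (auto intro!: continuous_at_imp_continuous_on DERIV_isCont)
  qed (use assms(2) smooth_on_continuous_on in auto)
  have "Ck k S (\<lambda>x. h (f x))" for k
  proof (induction k)
    case 0
    then show ?case using cont by simp
  next
    case (Suc k)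
    have "Ck k S (\<lambda>x. h' (f x) * partial j f x)" for j
      using assms(2)[unfolded smooth_on_def, rule_format, of "Suc k"]
      by (intro Ck_mult[OF assms(1)] step[OF Suc]) auto
    then show ?case
      by (intro Ck_SucI[OF assms(1) cont, where D = "\<lambda>j x. h' (f x) * partial j f x"]
          has_partial_derivative_compose h smooth_on_partial(1)[OF assms(2)])
  qed
  then show ?thesis by (simp add: smooth_on_def)
qed

text \<open>Two bootstraps: the inverse satisfies y' = - y * y, and then y = t powr a satisfies y' =
  a * y * inverse t, whose right-hand side uses the inverse already known to be smooth.\<close>

lemma smooth_on_powr:
  assumes "open S" "smooth_on S f" "\<And>x. x \<in> S \<Longrightarrow> f x > 0"
  shows "smooth_on S (\<lambda>x. f x powr a)"
proof -
  have inv: "smooth_on S (\<lambda>x. inverse (f x))"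
  proof (rule smooth_on_compose[OF assms(1,2), where h' = "\<lambda>t. - 1 * (inverse t * inverse t)"])
    show "(inverse has_real_derivative - 1 * (inverse (f x) * inverse (f x))) (at (f x))"
      if "x \<in> S" for x
      using assms(3)[OF that] by (auto intro!: derivative_eq_intros simp: power2_eq_square)
  qed (intro Ck_mult Ck_const assms)
  show ?thesis
  proof (rule smooth_on_compose[OF assms(1,2),
        where h = "\<lambda>t. t powr a" and h' = "\<lambda>t. a * (t powr a * inverse t)"])
    show "((\<lambda>t. t powr a) has_real_derivative a * (f x powr a * inverse (f x))) (at (f x))"
      if "x \<in> S" for x
      using assms(3)[OF that]
      by (auto intro!: derivative_eq_intros simp: powr_diff divide_inverse)
  qed (use inv in \<open>auto intro!: Ck_mult Ck_const assms simp: smooth_on_def\<close>)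
qed

subsection \<open>Supports, test functions and horizontal gradients\<close>

lemma eq_zero_notin_supp: "x \<notin> supp f \<Longrightarrow> f x = 0"
  using closure_subset[of "{x. f x \<noteq> 0}"] by (auto simp: supp_def)

lemma closed_supp: "closed (supp f)"
  by (simp add: supp_def)

lemma supp_subset: "(\<And>x. f x = 0 \<Longrightarrow> g x = 0) \<Longrightarrow> supp g \<subseteq> supp f"
  unfolding supp_def by (rule closure_mono) auto

lemma partial_notin_supp:
  assumes "x \<notin> supp f"
  shows "has_partial j f x" "partial j f x = 0"
proof -
  have "has_partial_derivative j f x 0"
    by (rule has_partial_derivative_cong_open[of "- supp f" x "\<lambda>_. 0"])
      (simp_all add: assms eq_zero_notin_supp closed_supp open_Compl has_partial_derivative_const)
  from has_partial_derivativeD[OF this]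
  show "has_partial j f x" "partial j f x = 0" by auto
qed

lemma gradL_notin_supp: "x \<notin> supp f \<Longrightarrow> gradL \<sigma> f x = 0"
  by (simp add: gradL_def Xf_def partial_notin_supp vec_eq_iff)

lemma gradL_compose:
  assumes "\<And>j. has_partial j f x" "(h has_real_derivative D) (at (f x))"
  shows "gradL \<sigma> (\<lambda>x. h (f x)) x = D *\<^sub>R gradL \<sigma> f x"
proof -
  have "partial j (\<lambda>x. h (f x)) x = D * partial j f x" for j
    by (rule has_partial_derivativeD(2)[OF has_partial_derivative_compose
          [OF has_partial_imp_derivative[OF assms(1)] assms(2)]])
  then show ?thesis
    by (simp add: gradL_def Xf_def vec_eq_iff sum_distrib_left mult_ac)
qed

lemma gradL_mult:
  assumes "\<And>j. has_partial j f x" "\<And>j. has_partial j g x"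
  shows "gradL \<sigma> (\<lambda>x. f x * g x) x = f x *\<^sub>R gradL \<sigma> g x + g x *\<^sub>R gradL \<sigma> f x"
proof -
  have "partial j (\<lambda>x. f x * g x) x = f x * partial j g x + g x * partial j f x" for j
    by (rule has_partial_derivativeD(2)[OF has_partial_derivative_mult
          [OF assms[THEN has_partial_imp_derivative]]])
  then show ?thesis
    by (simp add: gradL_def Xf_def vec_eq_iff sum_distrib_left sum.distrib algebra_simps)
qed

lemma smooth_on_has_partial: "smooth_on S f \<Longrightarrow> x \<in> S \<Longrightarrow> has_partial j f x"
  by (rule has_partial_derivativeD(1)[OF smooth_on_partial(1)])

lemma continuous_on_gradL:
  assumes "\<And>i j. continuous_on UNIV (\<sigma> i j)" "smooth_on S f"
  shows "continuous_on S (gradL \<sigma> f)"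
  unfolding gradL_def Xf_def
  by (intro continuous_on_vec_lambda continuous_intros smooth_on_partial(2)[OF assms(2)]
      continuous_on_subset[OF assms(1)]) auto

text \<open>The gain of \<open>pw\<close> over \<open>powr\<close>: since
  \<open>0 powr 0 = 0\<close>, the plain power with exponent 0 jumps at 0, whereas \<open>pw\<close>
  is constant there.\<close>

lemma continuous_on_pw:
  assumes "continuous_on S f" "\<And>x. x \<in> S \<Longrightarrow> f x \<ge> 0" "a \<ge> 0"
  shows "continuous_on S (\<lambda>x. pw (f x) a)"
  using assms by (cases "a = 0") (auto simp: pw_def intro!: continuous_on_powr' continuous_on_const)

text \<open>The factor \<open>g\<close> may be singular outside \<open>U\<close>, for instance at
  the origin. The open sets \<open>U\<close> and \<open>- supp w\<close> cover the space, the
  product is smooth on the first and zero on the second, and \<open>Ck_Un\<close> glues the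
  two.\<close>

lemma test_fun_mult:
  assumes w: "test_fun S w" and g: "smooth_on U g" "open U" "supp w \<subseteq> U"
  shows "test_fun S (\<lambda>x. w x * g x)"
proof -
  have sub: "supp (\<lambda>x. w x * g x) \<subseteq> supp w"
    by (rule supp_subset) simp
  have U: "Ck k U (\<lambda>x. w x * g x)" for k
    using w g Ck_subset[of k UNIV w U] by (intro Ck_mult) (auto simp: test_fun_def smooth_on_def)
  have V: "Ck k (- supp w) (\<lambda>x. w x * g x)" for k
    by (rule Ck_cong[OF _ Ck_const[of _ _ 0]]) (auto simp: eq_zero_notin_supp closed_supp open_Compl)
  have "Ck k (U \<union> - supp w) (\<lambda>x. w x * g x)" for k
    by (intro Ck_Un U V g open_Compl closed_supp)
  moreover have "U \<union> - supp w = UNIV" using g(3) by auto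
  moreover have "compact (supp (\<lambda>x. w x * g x))"
    using w sub closed_supp compact_Int_closed[of "supp w" "supp (\<lambda>x. w x * g x)"]
    by (auto simp: test_fun_def Int_absorb1)
  ultimately show ?thesis using w sub by (auto simp: test_fun_def smooth_on_def)
qed

text \<open>For \<open>e > 0\<close> a smooth substitute for \<open>\<bar>t\<bar> powr p\<close>, which need not be smooth at 0. Subtracting the
  constant keeps the composition with \<open>u\<close> supported where \<open>u\<close> is.\<close>

definition regpow :: "real \<Rightarrow> real \<Rightarrow> real \<Rightarrow> real" where
  "regpow p e t = (t\<^sup>2 + e) powr (p / 2) - e powr (p / 2)"

lemma regpow_deriv:
  assumes "e > 0"
  shows "(regpow p e has_real_derivative p * (t\<^sup>2 + e) powr (p / 2 - 1) * t) (at t)"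
proof -
  have "t\<^sup>2 + e > 0" using assms by (simp add: add_nonneg_pos)
  then show ?thesis
    unfolding regpow_def[abs_def] by (auto intro!: derivative_eq_intros)
qed

lemma test_fun_regpow:
  assumes "test_fun S u" "e > 0"
  shows "test_fun S (\<lambda>x. regpow p e (u x))"
proof -
  have u: "smooth_on UNIV u" using assms by (simp add: test_fun_def)
  have pos: "(u x)\<^sup>2 + e > 0" for x using assms by (simp add: add_nonneg_pos)
  have "smooth_on UNIV (\<lambda>x. (u x * u x + e) powr (p / 2) + - (e powr (p / 2)))"
    using pos u by (intro smooth_on_add smooth_on_powr smooth_on_mult smooth_on_const)
      (auto simp: power2_eq_square)
  then have "smooth_on UNIV (\<lambda>x. regpow p e (u x))"
    by (simp add: regpow_def power2_eq_square)
  moreover have sub: "supp (\<lambda>x. regpow p e (u x)) \<subseteq> supp u"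
    by (rule supp_subset) (simp add: regpow_def)
  moreover have "compact (supp (\<lambda>x. regpow p e (u x)))"
    using assms sub closed_supp compact_Int_closed[of "supp u" "supp (\<lambda>x. regpow p e (u x))"]
    by (auto simp: test_fun_def Int_absorb1)
  ultimately show ?thesis using assms by (auto simp: test_fun_def)
qed

subsection \<open>A Riccati equation from Bessel's equation\<close>

definition bessel_ser :: "real \<Rightarrow> real" where
  "bessel_ser t = (\<Sum>k. (-1)^k / (fact k)^2 * t^k)"

text \<open>With \<open>J\<^sub>0 z = E (z\<^sup>2 / 4)\<close>, Bessel's equation becomes \<open>t E'' + E' + E = 0\<close>.\<close>

lemma bessel_ser_ode:
  obtains E' E'' :: "real \<Rightarrow> real"
  where "\<And>t. (bessel_ser has_real_derivative E' t) (at t)"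
    "\<And>t. (E' has_real_derivative E'' t) (at t)"
    "\<And>t. t * E'' t + E' t + bessel_ser t = 0"
proof -
  define c :: "nat \<Rightarrow> real" where "c = (\<lambda>k. (-1)^k / (fact k)^2)"
  have sum0: "summable (\<lambda>n. c n * t ^ n)" for t :: real
  proof (rule summable_comparison_test')
    show "summable (\<lambda>n. inverse (fact n) * \<bar>t\<bar> ^ n)" by (rule summable_exp)
    show "norm (c n * t ^ n) \<le> inverse (fact n) * \<bar>t\<bar> ^ n" if "n \<ge> 0" for n
    proof -
      have "(fact n :: real) * 1 \<le> fact n * fact n"
        by (intro mult_left_mono) (auto simp: fact_ge_1)
      then have le: "inverse (fact n * fact n) \<le> (inverse (fact n) :: real)"
        by (intro le_imp_inverse_le) auto
      have "norm (c n * t ^ n) = inverse (fact n * fact n) * \<bar>t\<bar> ^ n"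
        by (simp add: c_def abs_mult power_abs divide_inverse power2_eq_square)
      also have "\<dots> \<le> inverse (fact n) * \<bar>t\<bar> ^ n"
        by (intro mult_right_mono le) auto
      finally show ?thesis .
    qed
  qed
  have sum1: "summable (\<lambda>n. diffs c n * t ^ n)" for t
    by (rule termdiff_converges_all[OF sum0])
  have sum2: "summable (\<lambda>n. diffs (diffs c) n * t ^ n)" for t
    by (rule termdiff_converges_all[OF sum1])
  define E' E'' where "E' = (\<lambda>t. \<Sum>n. diffs c n * t ^ n)"
    and "E'' = (\<lambda>t. \<Sum>n. diffs (diffs c) n * t ^ n)"
  have E: "bessel_ser = (\<lambda>t. \<Sum>n. c n * t ^ n)" by (simp add: bessel_ser_def c_def fun_eq_iff)
  \<comment> \<open>This is the differential equation read off at the coefficient of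
    \<open>t ^ n\<close>: the factor t in t E'' shifts the index, so that term contributes
    \<open>real n * diffs c n\<close>.\<close>
  have rec: "real n * diffs c n + diffs c n + c n = 0" for n
  proof -
    have "(real (Suc n))\<^sup>2 * c (Suc n) = - c n"
      by (simp add: c_def power_mult_distrib del: of_nat_Suc)
    then show ?thesis
      by (simp add: diffs_def algebra_simps power2_eq_square)
  qed
  show thesis
  proof
    show "(bessel_ser has_real_derivative E' t) (at t)" for t
      unfolding E E'_def by (rule termdiffs_strong_converges_everywhere[OF sum0])
    show "(E' has_real_derivative E'' t) (at t)" for t
      unfolding E'_def E''_def by (rule termdiffs_strong_converges_everywhere[OF sum1])
    show "t * E'' t + E' t + bessel_ser t = 0" for t
    proof -
      have "(\<lambda>n. diffs (diffs c) n * t ^ n * t) sums (E'' t * t)"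
        unfolding E''_def by (intro sums_mult2 summable_sums sum2)
      then have "(\<lambda>n. real (Suc n) * diffs c (Suc n) * t ^ Suc n) sums (E'' t * t)"
        by (simp add: diffs_def mult_ac)
      \<comment> \<open>The index shift loses nothing, because the new term at n = 0 has the factor
        0.\<close>
      then have "(\<lambda>n. real n * diffs c n * t ^ n) sums (E'' t * t)"
        by (subst (asm) sums_Suc_iff) simp
      from sums_add[OF sums_add[OF this summable_sums[OF sum1]] summable_sums[OF sum0]]
      have "(\<lambda>n. (real n * diffs c n + diffs c n + c n) * t ^ n) sums
          (E'' t * t + E' t + bessel_ser t)"
        by (simp add: E E'_def algebra_simps)
      then show ?thesis by (simp add: rec sums_unique2 mult.commute)
    qed
  qed
qed

text \<open>\<open>M s = s J' s / J s\<close> for \<open>J s = J\<^sub>0 (z0 s / R)\<close>, whose second-order equation turns into a Riccati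
  equation.\<close>

lemma bessel_riccati:
  assumes "R > 0" "z0 > 0" and nz: "\<And>z. 0 < z \<Longrightarrow> z < z0 \<Longrightarrow> besselJ0 z \<noteq> 0"
  obtains M :: "real \<Rightarrow> real" where
    "\<And>s. 0 < s \<Longrightarrow> s < R \<Longrightarrow>
       (M has_real_derivative - (z0\<^sup>2 / R\<^sup>2) * s - (M s)\<^sup>2 / s) (at s)"
proof -
  obtain E' E'' where E': "\<And>t. (bessel_ser has_real_derivative E' t) (at t)"
    and E'': "\<And>t. (E' has_real_derivative E'' t) (at t)"
    and ode: "\<And>t. t * E'' t + E' t + bessel_ser t = 0"
    by (rule bessel_ser_ode, rule that)
  \<comment> \<open>Chosen so that \<open>bessel_ser (l * s\<^sup>2)\<close> is
    \<open>besselJ0 (z0 * s / R)\<close>. Differentiating in s and multiplying by s brings down the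
    factor \<open>2 * (l * s\<^sup>2)\<close> in the numerator of \<open>M\<close>.\<close>
  define l where "l = z0\<^sup>2 / R\<^sup>2 / 4"
  define M where "M = (\<lambda>s. 2 * (l * s\<^sup>2) * E' (l * s\<^sup>2) / bessel_ser (l * s\<^sup>2))"
  show thesis
  proof
    fix s :: real assume s: "0 < s" "s < R"
    define t where "t = l * s\<^sup>2"
    have z: "0 < z0 * s / R" "z0 * s / R < z0"
      using s assms by (auto simp: field_simps)
    have "t = (z0 * s / R / 2)\<^sup>2"
      by (simp add: t_def l_def power_divide power_mult_distrib)
    then have "bessel_ser t = besselJ0 (z0 * s / R)"
      by (simp add: bessel_ser_def besselJ0_def power_mult)
    with nz[OF z] have b: "bessel_ser t \<noteq> 0" by simp
    have dt: "((\<lambda>s. l * s\<^sup>2) has_real_derivative 2 * t / s) (at s)"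
      using s by (auto intro!: derivative_eq_intros simp: t_def power2_eq_square)
    have Ms: "M s = 2 * t * E' t / bessel_ser t" by (simp add: M_def t_def)
    note d1 = DERIV_chain2[OF E'[of "l * s\<^sup>2"] dt]
    note d2 = DERIV_chain2[OF E''[of "l * s\<^sup>2"] dt]
    have "(M has_real_derivative
        ((2 * t * (E'' t * (2 * t / s)) + 2 * (2 * t / s) * E' t) * bessel_ser t
          - 2 * t * E' t * (E' t * (2 * t / s))) / (bessel_ser t * bessel_ser t)) (at s)"
      unfolding M_def using b
      by (intro DERIV_cong[OF DERIV_divide[OF DERIV_mult[OF DERIV_cmult[OF dt, of 2] d2] d1]])
        (simp_all add: t_def[symmetric] algebra_simps)
    also have "((2 * t * (E'' t * (2 * t / s)) + 2 * (2 * t / s) * E' t) * bessel_ser t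
          - 2 * t * E' t * (E' t * (2 * t / s))) / (bessel_ser t * bessel_ser t)
        = 4 * t / s * (t * E'' t + E' t) / bessel_ser t - (M s)\<^sup>2 / s"
      using b s by (simp add: Ms field_simps power2_eq_square)
    also have "t * E'' t + E' t = - bessel_ser t" using ode[of t] by simp
    also have "4 * t / s * - bessel_ser t / bessel_ser t = - (z0\<^sup>2 / R\<^sup>2) * s"
      using b s by (simp add: t_def l_def power2_eq_square)
    finally show "(M has_real_derivative - (z0\<^sup>2 / R\<^sup>2) * s - (M s)\<^sup>2 / s) (at s)" .
  qed
qed

subsection \<open>Elementary inequalities\<close>

text \<open>Young's inequality for \<open>x powr a\<close> and 1 with weights 1/a and 1 - 1/a,
  multiplied by a.\<close>

lemma bernoulli_powr:
  fixes a x :: real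
  assumes "a \<ge> 1" "x \<ge> 0"
  shows "1 + a * (x - 1) \<le> x powr a"
proof (cases "x = 0")
  case False
  have "(x powr a) powr (1 / a) * 1 powr (1 - 1 / a) \<le> 1 / a * x powr a + (1 - 1 / a) * 1"
    using assms False by (intro Youngs_inequality_0) auto
  then have "a * x \<le> a * (1 / a * x powr a + (1 - 1 / a))"
    using assms by (intro mult_left_mono) (auto simp: powr_powr)
  then show ?thesis using assms by (simp add: algebra_simps)
qed (use assms in simp)

text \<open>Bernoulli's inequality for \<open>(Y / a)\<^sup>2\<close>, then \<open>(Y + a)\<^sup>2 \<ge> 2 m (Y + a) - m\<^sup>2\<close>, which makes the bound
  linear in \<open>Y\<close>.\<close>

lemma power_expansion_bound:
  fixes a Y m p :: real
  assumes "p \<ge> 2"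
  shows "\<bar>Y\<bar> powr p \<ge> \<bar>a\<bar> powr p
    + pw \<bar>a\<bar> (p - 2) * (p * Y * (m - a) + p * a * (m - a) - p / 2 * m\<^sup>2)"
proof (cases "a = 0")
  case True
  show ?thesis
  \<comment> \<open>For a = 0 the factor \<open>pw 0 (p - 2)\<close> is 1 if p = 2 and 0 otherwise,
    so only p = 2 leaves something to show.\<close>
  proof (cases "p = 2")
    case True
    have "Y\<^sup>2 \<ge> 2 * Y * m - m\<^sup>2"
      using zero_le_power2[of "Y - m"] by (simp add: power2_diff)
    with \<open>a = 0\<close> True show ?thesis by (simp add: pw_def)
  qed (use True in \<open>simp add: pw_def\<close>)
next
  case False
  define t where "t = (Y / a)\<^sup>2 - 1"
  have sq: "(\<bar>x\<bar> powr p) = (x\<^sup>2) powr (p / 2)" for x :: real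
  proof -
    have "\<bar>x\<bar> powr p = (\<bar>x\<bar> powr 2) powr (p / 2)"
      by (simp add: powr_powr del: powr_numeral)
    then show ?thesis by simp
  qed
  have "1 + p / 2 * t \<le> (1 + t) powr (p / 2)"
    using bernoulli_powr[of "p / 2" "1 + t"] assms by (simp add: t_def)
  also have "(1 + t) powr (p / 2) = \<bar>Y\<bar> powr p / \<bar>a\<bar> powr p"
    by (simp add: t_def sq power_divide powr_divide)
  finally have "\<bar>Y\<bar> powr p \<ge> \<bar>a\<bar> powr p * (1 + p / 2 * t)"
    using False by (simp add: field_simps)
  moreover have "\<bar>a\<bar> powr p = pw \<bar>a\<bar> (p - 2) * a\<^sup>2"
    using False by (simp add: pw_def powr_diff)
  moreover have "pw \<bar>a\<bar> (p - 2) * (a\<^sup>2 * (1 + p / 2 * t))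
    \<ge> pw \<bar>a\<bar> (p - 2) * (a\<^sup>2 + p * Y * (m - a) + p * a * (m - a) - p / 2 * m\<^sup>2)"
  proof (rule mult_left_mono)
    have "p / 2 * (Y + a - m)\<^sup>2 \<ge> 0" using assms by simp
    moreover have "a\<^sup>2 * (1 + p / 2 * t) = a\<^sup>2 + p / 2 * (Y\<^sup>2 - a\<^sup>2)"
      using False by (simp add: t_def field_simps)
    ultimately show "a\<^sup>2 + p * Y * (m - a) + p * a * (m - a) - p / 2 * m\<^sup>2 \<le> a\<^sup>2 * (1 + p / 2 * t)"
      by (simp add: power2_eq_square algebra_simps)
  qed (simp add: pw_def)
  ultimately show ?thesis by (simp add: algebra_simps)
qed

text \<open>The Riccati solution is available strictly below its radius, while the support of a test
  function may reach d = R. Larger radii are therefore used first, and this limit recovers the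
  constant at R.\<close>

lemma add_divide_square_le_limit:
  fixes a b L R :: real
  assumes "R > 0" "\<And>R'. R' > R \<Longrightarrow> a + b / R'\<^sup>2 \<le> L"
  shows "a + b / R\<^sup>2 \<le> L"
proof (rule tendsto_upperbound)
  show "((\<lambda>r. a + b / r\<^sup>2) \<longlongrightarrow> a + b / R\<^sup>2) (at_right R)"
    using assms(1) by (auto intro!: tendsto_eq_intros)
  show "\<forall>\<^sub>F r in at_right R. a + b / r\<^sup>2 \<le> L"
    using assms(2) by (auto simp: eventually_at_right_field intro: exI[of _ "R + 1"])
qed simp

subsection \<open>Vanishing flux\<close>

text \<open>The harmonic function v is a power of d or - ln d, so its gradient is a nonzero multiple
  of a power of d times the gradient of d. Hence |grad v|^(q-2) grad v is a nonzero constant times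
  the field in question.\<close>

lemma radial_flux_zero:
  fixes d :: "real^'n::finite \<Rightarrow> real" and \<sigma> :: "'h::finite \<Rightarrow> 'n \<Rightarrow> real^'n \<Rightarrow> real"
  assumes d: "smooth_on (- {0}) d" "\<And>x. x \<noteq> 0 \<Longrightarrow> d x > 0"
    and q: "q \<ge> 2"
    and harm: "q \<noteq> Q \<Longrightarrow> Lp_harmonic \<sigma> q (\<lambda>x. d x powr ((q - Q) / (q - 1))) (- {0})"
      "q = Q \<Longrightarrow> Lp_harmonic \<sigma> q (\<lambda>x. - ln (d x)) (- {0})"
    and \<phi>: "test_fun (- {0}) \<phi>"
  shows "(\<integral>x. ((d x powr (1 - Q) * pw (norm (gradL \<sigma> d x)) (q - 2)) *\<^sub>R gradL \<sigma> d x)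
            \<bullet> gradL \<sigma> \<phi> x \<partial>lborel) = 0"
proof -
  \<comment> \<open>The exponent of d after differentiating v; it equals -1 in the logarithmic case.
    Raising the gradient to the power q - 1 turns it into 1 - Q.\<close>
  let ?e = "(1 - Q) / (q - 1)"
  obtain v C where v: "Lp_harmonic \<sigma> q v (- {0})" and C: "C \<noteq> 0"
    and grad: "\<And>x. x \<noteq> 0 \<Longrightarrow> gradL \<sigma> v x = (C * d x powr ?e) *\<^sub>R gradL \<sigma> d x"
  proof (cases "q = Q")
    case False
    let ?c = "(q - Q) / (q - 1)"
    show thesis
    proof (rule that[OF harm(1)[OF False]])
      show "?c \<noteq> 0" using False q by auto
      show "gradL \<sigma> (\<lambda>x. d x powr ?c) x = (?c * d x powr ?e) *\<^sub>R gradL \<sigma> d x" if "x \<noteq> 0" for x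
      proof (rule gradL_compose)
        have "?c - 1 = ?e" using q by (simp add: field_simps)
        then show "((\<lambda>t. t powr ?c) has_real_derivative ?c * d x powr ?e) (at (d x))"
          using d(2)[OF that] has_real_derivative_powr[of "d x" ?c] by simp
      qed (use that in \<open>auto intro: smooth_on_has_partial[OF d(1)]\<close>)
    qed
  next
    case True
    show thesis
    proof (rule that[OF harm(2)[OF True], of "- 1"])
      show "gradL \<sigma> (\<lambda>x. - ln (d x)) x = (- 1 * d x powr ?e) *\<^sub>R gradL \<sigma> d x" if "x \<noteq> 0" for x
      proof (rule gradL_compose)
        have "?e = - 1" using q True by (simp add: field_simps)
        then show "((\<lambda>t. - ln t) has_real_derivative - 1 * d x powr ?e) (at (d x))"
          using d(2)[OF that] by (auto intro!: derivative_eq_intros simp: powr_minus divide_inverse)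
      qed (use that in \<open>auto intro: smooth_on_has_partial[OF d(1)]\<close>)
    qed simp
  qed
  let ?F = "\<lambda>x. ((d x powr (1 - Q) * pw (norm (gradL \<sigma> d x)) (q - 2)) *\<^sub>R gradL \<sigma> d x)
            \<bullet> gradL \<sigma> \<phi> x"
  have pointwise: "norm (gradL \<sigma> v x) powr (q - 2) * (gradL \<sigma> v x \<bullet> gradL \<sigma> \<phi> x)
      = (C * \<bar>C\<bar> powr (q - 2)) * ?F x" for x
  \<comment> \<open>In these degenerate cases both sides are 0: the origin lies off the support of
    \<phi>, and where \<open>gradL \<sigma> d x\<close> vanishes it remains as a factor, so the
    difference between \<open>pw\<close> and \<open>powr\<close> at q = 2 is harmless.\<close>
  proof (cases "x = 0 \<or> gradL \<sigma> d x = 0")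
    case True
    moreover have "gradL \<sigma> \<phi> 0 = 0"
      using \<phi> by (intro gradL_notin_supp) (auto simp: test_fun_def)
    ultimately show ?thesis using grad by (cases "x = 0") auto
  next
    case False
    then have "d x > 0" using d by auto
    have "E * (q - 2) + E = E * (q - 1)" for E by (simp add: algebra_simps)
    from this[of ?e] have "?e * (q - 2) + ?e = 1 - Q" using q by simp
    then have e: "d x powr (1 - Q) = d x powr (?e * (q - 2)) * d x powr ?e"
      by (simp only: powr_add[symmetric])
    have n: "norm (gradL \<sigma> v x) = \<bar>C\<bar> * d x powr ?e * norm (gradL \<sigma> d x)"
      using False grad by (simp add: abs_mult)
    have "norm (gradL \<sigma> v x) powr (q - 2)
        = \<bar>C\<bar> powr (q - 2) * d x powr (?e * (q - 2)) * pw (norm (gradL \<sigma> d x)) (q - 2)"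
      unfolding n using False by (simp add: powr_mult powr_powr pw_def)
    then show ?thesis using False e by (simp add: grad)
  qed
  have "(\<integral>x. norm (gradL \<sigma> v x) powr (q - 2) * (gradL \<sigma> v x \<bullet> gradL \<sigma> \<phi> x) \<partial>lborel) = 0"
    using v \<phi> by (simp add: Lp_harmonic_def)
  then have "(C * \<bar>C\<bar> powr (q - 2)) * (\<integral>x. ?F x \<partial>lborel) = 0"
    unfolding pointwise integral_mult_right_zero .
  then show ?thesis using C by simp
qed

section \<open>From test functions to |u|^p g by regularization\<close>

lemma set_integrable_continuous_compact:
  fixes f :: "'a::euclidean_space \<Rightarrow> real"
  shows "compact K \<Longrightarrow> continuous_on K f \<Longrightarrow> set_integrable lborel K f"
  unfolding set_integrable_def by (rule borel_integrable_compact)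

text \<open>Formally \<open>F\<close> is \<open>A\<close> paired with the gradient of |u|^p g, which
  need not be a test function. The flux hypothesis applies to \<open>regpow p e u\<close> times g,
  and e tends to 0 by dominated convergence.\<close>

lemma flux_zero_powr:
  fixes A :: "real^'n::finite \<Rightarrow> real^'h::finite" and u g :: "real^'n \<Rightarrow> real"
  assumes \<sigma>: "\<And>i j. continuous_on UNIV (\<sigma> i j)"
    and U: "open U" "continuous_on U A"
    and flux: "\<And>\<phi>. test_fun U \<phi> \<Longrightarrow> (\<integral>x. A x \<bullet> gradL \<sigma> \<phi> x \<partial>lborel) = 0"
    and u: "test_fun U u" and g: "smooth_on U g" and p: "p \<ge> 2"
  defines "F \<equiv> \<lambda>x. p * (pw \<bar>u x\<bar> (p - 2) * u x) * (g x * (A x \<bullet> gradL \<sigma> u x))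
            + \<bar>u x\<bar> powr p * (A x \<bullet> gradL \<sigma> g x)"
  shows "set_integrable lborel (supp u) F" "(LINT x:supp u|lborel. F x) = 0"
proof -
  let ?K = "supp u"
  have K: "compact ?K" "?K \<subseteq> U" using u by (auto simp: test_fun_def)
  have su: "smooth_on UNIV u" using u by (simp add: test_fun_def)
  define a where "a = (\<lambda>x. g x * (A x \<bullet> gradL \<sigma> u x))"
  define b where "b = (\<lambda>x. A x \<bullet> gradL \<sigma> g x)"
  have cu: "continuous_on ?K u"
    using smooth_on_continuous_on[OF su] continuous_on_subset by blast
  have ca: "continuous_on ?K a" unfolding a_def
    by (intro continuous_intros continuous_on_subset[OF U(2) K(2)]
      continuous_on_subset[OF smooth_on_continuous_on[OF g] K(2)]
      continuous_on_subset[OF continuous_on_gradL[OF \<sigma> su]]) auto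
  have cb: "continuous_on ?K b" unfolding b_def
    by (intro continuous_intros continuous_on_subset[OF U(2) K(2)]
      continuous_on_subset[OF continuous_on_gradL[OF \<sigma> g] K(2)])
  have F: "F = (\<lambda>x. p * (pw \<bar>u x\<bar> (p - 2) * u x) * a x + \<bar>u x\<bar> powr p * b x)"
    by (simp add: F_def a_def b_def)
  have "continuous_on ?K (\<lambda>x. \<bar>u x\<bar> powr p)"
    using p by (intro continuous_on_powr' continuous_on_rabs continuous_on_const cu) auto
  then have cF: "continuous_on ?K F"
    unfolding F using p
    by (intro continuous_on_add continuous_on_mult continuous_on_pw continuous_on_rabs
        continuous_on_const ca cb cu) auto
  show "set_integrable lborel ?K F"
    by (rule set_integrable_continuous_compact[OF K(1) cF])
  define e :: "nat \<Rightarrow> real" where "e = (\<lambda>n. 1 / (real n + 1))"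
  have e: "0 < e n" "e n \<le> 1" for n by (auto simp: e_def)
  \<comment> \<open>The same pairing for the regularized function, expanded by the product and chain
    rules.\<close>
  define f where "f = (\<lambda>n x. p * (((u x)\<^sup>2 + e n) powr (p / 2 - 1) * u x) * a x
     + regpow p (e n) (u x) * b x)"
  have pos: "(u x)\<^sup>2 + e n > 0" for n x using e by (simp add: add_nonneg_pos)
  have cf: "continuous_on ?K (f n)" for n
    unfolding f_def regpow_def using pos[of _ n] e(1)[of n]
    by (intro continuous_intros ca cb cu) (auto simp: less_le)
  have zero: "(LINT x:?K|lborel. f n x) = 0" for n
  proof -
    have reg: "test_fun U (\<lambda>x. regpow p (e n) (u x))"
      by (rule test_fun_regpow[OF u e(1)])
    have supp: "supp (\<lambda>x. regpow p (e n) (u x) * g x) \<subseteq> ?K"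
      by (rule supp_subset) (simp add: regpow_def)
    have eq: "A x \<bullet> gradL \<sigma> (\<lambda>x. regpow p (e n) (u x) * g x) x = indicator ?K x *\<^sub>R f n x" for x
    proof (cases "x \<in> ?K")
      case True
      then have x: "x \<in> U" using K by auto
      have "gradL \<sigma> (\<lambda>x. regpow p (e n) (u x) * g x) x
        = regpow p (e n) (u x) *\<^sub>R gradL \<sigma> g x
          + g x *\<^sub>R gradL \<sigma> (\<lambda>x. regpow p (e n) (u x)) x"
        using reg smooth_on_has_partial[OF _ UNIV_I] smooth_on_has_partial[OF g x]
        by (intro gradL_mult) (auto simp: test_fun_def)
      also have "gradL \<sigma> (\<lambda>x. regpow p (e n) (u x)) x
        = (p * ((u x)\<^sup>2 + e n) powr (p / 2 - 1) * u x) *\<^sub>R gradL \<sigma> u x"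
        by (rule gradL_compose[OF smooth_on_has_partial[OF su UNIV_I] regpow_deriv[OF e(1)]])
      finally show ?thesis
        using True by (simp add: f_def a_def b_def inner_add_right algebra_simps)
    next
      case False
      then have "gradL \<sigma> (\<lambda>x. regpow p (e n) (u x) * g x) x = 0"
        using supp by (intro gradL_notin_supp) auto
      with False show ?thesis by simp
    qed
    have "supp (\<lambda>x. regpow p (e n) (u x)) \<subseteq> U" using reg by (simp add: test_fun_def)
    then have "(\<integral>x. A x \<bullet> gradL \<sigma> (\<lambda>x. regpow p (e n) (u x) * g x) x \<partial>lborel) = 0"
      by (intro flux test_fun_mult[OF reg g U(1)])
    then show ?thesis unfolding eq set_lebesgue_integral_def .
  qed
  have "(\<lambda>n. LINT x:?K|lborel. f n x) \<longlonglongrightarrow> (LINT x:?K|lborel. F x)"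
    unfolding set_lebesgue_integral_def
  proof (rule integral_dominated_convergence)
    \<comment> \<open>Since p \<ge> 2, both powers increase with the regularization parameter, so
      its largest value 1 gives a common majorant.\<close>
    let ?w = "\<lambda>x. p * (((u x)\<^sup>2 + 1) powr (p / 2 - 1) * \<bar>u x\<bar>) * \<bar>a x\<bar>
       + ((u x)\<^sup>2 + 1) powr (p / 2) * \<bar>b x\<bar>"
    have "(u x)\<^sup>2 + 1 \<noteq> 0" for x
      using add_nonneg_pos[of "(u x)\<^sup>2" 1] by simp
    then have "continuous_on ?K ?w"
      by (intro continuous_intros ca cb cu) auto
    then show "integrable lborel (\<lambda>x. indicator ?K x *\<^sub>R ?w x)"
      using set_integrable_continuous_compact[OF K(1)] by (simp add: set_integrable_def)
    show "(\<lambda>x. indicator ?K x *\<^sub>R F x) \<in> borel_measurable lborel"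
      using borel_integrable_compact[OF K(1) cF] by (rule borel_measurable_integrable)
    show "(\<lambda>x. indicator ?K x *\<^sub>R f n x) \<in> borel_measurable lborel" for n
      using borel_integrable_compact[OF K(1) cf] by (rule borel_measurable_integrable)
    show "AE x in lborel. (\<lambda>n. indicator ?K x *\<^sub>R f n x) \<longlonglongrightarrow> indicator ?K x *\<^sub>R F x"
    proof (rule AE_I2, rule tendsto_scaleR[OF tendsto_const])
      fix x
      have e0: "e \<longlonglongrightarrow> 0"
        unfolding e_def using LIMSEQ_inverse_real_of_nat by (simp add: inverse_eq_divide add.commute)
      have sq: "(u x)\<^sup>2 powr c = \<bar>u x\<bar> powr (2 * c)" for c
      proof -
        have "(u x)\<^sup>2 powr c = (\<bar>u x\<bar> powr 2) powr c" by simp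
        then show ?thesis by (simp only: powr_powr)
      qed
      have 1: "(\<lambda>n. ((u x)\<^sup>2 + e n) powr (p / 2 - 1) * u x) \<longlonglongrightarrow> pw \<bar>u x\<bar> (p - 2) * u x"
      \<comment> \<open>Continuity of the power in its base requires a nonzero limit; at a zero of u
        the extra factor \<open>u x\<close> makes both sides 0.\<close>
      proof (cases "u x = 0")
        case False
        then have "pw \<bar>u x\<bar> (p - 2) = ((u x)\<^sup>2 + 0) powr (p / 2 - 1)"
          by (simp add: sq pw_def)
        then show ?thesis
          using False by (simp only:) (intro tendsto_intros e0, simp)
      qed simp
      have 2: "(\<lambda>n. regpow p (e n) (u x)) \<longlonglongrightarrow> \<bar>u x\<bar> powr p"
      proof -
        have "(\<lambda>n. ((u x)\<^sup>2 + e n) powr (p / 2)) \<longlonglongrightarrow> ((u x)\<^sup>2 + 0) powr (p / 2)"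
          by (rule tendsto_powr'[OF tendsto_add[OF tendsto_const e0] tendsto_const])
            (use p less_imp_le[OF pos] in simp)
        moreover have "(\<lambda>n. e n powr (p / 2)) \<longlonglongrightarrow> 0 powr (p / 2)"
          by (rule tendsto_powr'[OF e0 tendsto_const]) (use p less_imp_le[OF e(1)] in simp)
        ultimately have "(\<lambda>n. ((u x)\<^sup>2 + e n) powr (p / 2) - e n powr (p / 2))
            \<longlonglongrightarrow> ((u x)\<^sup>2 + 0) powr (p / 2) - 0 powr (p / 2)"
          by (rule tendsto_diff)
        then show ?thesis by (simp add: sq regpow_def)
      qed
      show "(\<lambda>n. f n x) \<longlonglongrightarrow> F x"
        unfolding f_def F by (intro tendsto_intros 1 2)
    qed
    show "AE x in lborel. norm (indicator ?K x *\<^sub>R f n x) \<le> indicator ?K x *\<^sub>R ?w x" for n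
    proof (rule AE_I2)
      fix x
      have "\<bar>regpow p (e n) (u x)\<bar> \<le> ((u x)\<^sup>2 + 1) powr (p / 2)"
      proof -
        have "e n powr (p / 2) \<le> ((u x)\<^sup>2 + e n) powr (p / 2)"
          using p e[of n] by (intro powr_mono2) auto
        moreover have "((u x)\<^sup>2 + e n) powr (p / 2) \<le> ((u x)\<^sup>2 + 1) powr (p / 2)"
          using p e[of n] by (intro powr_mono2) auto
        moreover have "0 \<le> e n powr (p / 2)" by simp
        ultimately show ?thesis unfolding regpow_def by linarith
      qed
      then have 1: "\<bar>regpow p (e n) (u x) * b x\<bar> \<le> ((u x)\<^sup>2 + 1) powr (p / 2) * \<bar>b x\<bar>"
        unfolding abs_mult by (rule mult_right_mono) simp
      have "((u x)\<^sup>2 + e n) powr (p / 2 - 1) \<le> ((u x)\<^sup>2 + 1) powr (p / 2 - 1)"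
        using p e[of n] by (intro powr_mono2) auto
      then have "p * (((u x)\<^sup>2 + e n) powr (p / 2 - 1) * \<bar>u x\<bar>) * \<bar>a x\<bar>
          \<le> p * (((u x)\<^sup>2 + 1) powr (p / 2 - 1) * \<bar>u x\<bar>) * \<bar>a x\<bar>"
        using p by (intro mult_right_mono mult_left_mono) auto
      moreover have "\<bar>p * (((u x)\<^sup>2 + e n) powr (p / 2 - 1) * u x) * a x\<bar>
          = p * (((u x)\<^sup>2 + e n) powr (p / 2 - 1) * \<bar>u x\<bar>) * \<bar>a x\<bar>"
        using p by (simp add: abs_mult)
      ultimately have "norm (f n x) \<le> ?w x"
        unfolding f_def real_norm_def using 1 by linarith
      then show "norm (indicator ?K x *\<^sub>R f n x) \<le> indicator ?K x *\<^sub>R ?w x"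
        by (simp split: split_indicator)
    qed
  qed
  then show "(LINT x:?K|lborel. F x) = 0" by (simp add: zero LIMSEQ_const_iff)
qed

subsection \<open>The weighted inequality\<close>

text \<open>The one-dimensional inequality, with \<open>y\<close> in the role of \<open>u'(s)\<close>: up to the factor \<open>s powr (1 - Q)\<close>
  the last summand on the left is the derivative of \<open>\<bar>u\<bar> powr p * G\<close>. The value of \<open>l\<close> is immaterial, because it
  cancels against the Riccati equation in \<open>G'\<close>.\<close>

lemma radial_profile_bound:
  fixes s y m p Q \<theta> l U :: real
  assumes "s > 0" "p \<ge> 2"
  defines "\<kappa> \<equiv> (Q - p * \<theta>) / p"
  defines "k \<equiv> pw \<bar>\<kappa>\<bar> (p - 2)"
  defines "G \<equiv> s powr (Q - p * \<theta>) * (k * (2 / p * m - \<kappa>))"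
    and "G' \<equiv> (Q - p * \<theta>) * s powr (Q - p * \<theta> - 1) * (k * (2 / p * m - \<kappa>))
            + s powr (Q - p * \<theta>) * (k * (2 / p * (- l * s - m\<^sup>2 / s)))"
  shows "\<bar>\<kappa>\<bar> powr p * (\<bar>U\<bar> powr p / s powr (p * \<theta>))
      + 2 / p * k * l * (\<bar>U\<bar> powr p / s powr (p * \<theta> - 2))
      + s powr (1 - Q) * (p * (pw \<bar>U\<bar> (p - 2) * U) * G * y + \<bar>U\<bar> powr p * G')
    \<le> \<bar>y\<bar> powr p / s powr (p * (\<theta> - 1))"
proof (cases "U = 0")
  case False
  \<comment> \<open>After division by \<open>\<bar>U\<bar> powr p / D\<close> the claim becomes
    \<open>power_expansion_bound\<close> at a = \<kappa>, with \<mu> for its free parameter. The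
    factor 2/p makes \<open>p / 2 * \<mu>\<^sup>2\<close> equal to \<open>2 / p * m\<^sup>2\<close>,
    exactly the quadratic Riccati term in \<open>G'\<close>.\<close>
  define Y \<mu> D where "Y = s * y / U" and "\<mu> = 2 / p * m" and "D = s powr (p * \<theta>)"
  have D: "D > 0" using assms by (simp add: D_def)
  have Q: "Q - p * \<theta> = p * \<kappa>" using assms by (simp add: \<kappa>_def)
  have D1: "s powr (p * (\<theta> - 1)) = D / s powr p"
    by (simp add: D_def powr_diff right_diff_distrib)
  have D2: "s powr (p * \<theta> - 2) = D / s\<^sup>2"
    using assms by (simp add: D_def powr_diff)
  have D3: "s powr (1 - Q) * s powr (Q - p * \<theta>) = s / D"
    using assms by (simp add: D_def powr_diff)
  have D4: "s powr (1 - Q) * s powr (Q - p * \<theta> - 1) = 1 / D"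
    using assms by (simp add: D_def powr_diff)
  have U: "pw \<bar>U\<bar> (p - 2) * U = \<bar>U\<bar> powr p / U"
    using False by (simp add: pw_def powr_diff power2_eq_square)
  have "\<bar>\<kappa>\<bar> powr p + k * (p * Y * (\<mu> - \<kappa>) + p * \<kappa> * (\<mu> - \<kappa>) - p / 2 * \<mu>\<^sup>2) \<le> \<bar>Y\<bar> powr p"
    unfolding k_def by (rule power_expansion_bound[OF assms(2)])
  then have "\<bar>U\<bar> powr p / D * (\<bar>\<kappa>\<bar> powr p
      + k * (p * Y * (\<mu> - \<kappa>) + p * \<kappa> * (\<mu> - \<kappa>) - p / 2 * \<mu>\<^sup>2)) \<le> \<bar>U\<bar> powr p / D * \<bar>Y\<bar> powr p"
    using D by (intro mult_left_mono) auto
  also have "\<bar>U\<bar> powr p / D * \<bar>Y\<bar> powr p = \<bar>y\<bar> powr p / s powr (p * (\<theta> - 1))"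
    using assms False by (simp add: D1 Y_def abs_mult powr_mult powr_divide)
  also have "\<bar>U\<bar> powr p / D * (\<bar>\<kappa>\<bar> powr p
      + k * (p * Y * (\<mu> - \<kappa>) + p * \<kappa> * (\<mu> - \<kappa>) - p / 2 * \<mu>\<^sup>2))
    = \<bar>\<kappa>\<bar> powr p * (\<bar>U\<bar> powr p / D) + 2 / p * k * l * (\<bar>U\<bar> powr p / (D / s\<^sup>2))
      + (p * (\<bar>U\<bar> powr p / U) * (s / D * (k * (\<mu> - \<kappa>))) * y
      + \<bar>U\<bar> powr p * ((p * \<kappa>) * (1 / D) * (k * (\<mu> - \<kappa>)) + s / D * (k * (2 / p * (- l * s - m\<^sup>2 / s)))))"
    using assms(1,2) False D by (simp add: Y_def \<mu>_def field_simps power2_eq_square)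
  also have "p * (\<bar>U\<bar> powr p / U) * (s / D * (k * (\<mu> - \<kappa>))) * y
      + \<bar>U\<bar> powr p * ((p * \<kappa>) * (1 / D) * (k * (\<mu> - \<kappa>)) + s / D * (k * (2 / p * (- l * s - m\<^sup>2 / s))))
    = s powr (1 - Q) * (p * (pw \<bar>U\<bar> (p - 2) * U) * G * y + \<bar>U\<bar> powr p * G')"
    unfolding U G_def G'_def D3[symmetric] D4[symmetric] Q[symmetric] \<mu>_def
    by (simp add: algebra_simps)
  finally show ?thesis unfolding D2 D_def .
qed (use assms in simp)

text \<open>Only the component of \<open>gu\<close> along \<open>gd\<close> enters. Its coefficient
  y = (gu . gd) / |gd|^2 plays the role of the radial derivative, and
  \<open>radial_profile_bound\<close> is multiplied by |gd|^(\<alpha>+p). Where \<open>gd\<close>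
  vanishes, both sides are 0.\<close>

lemma radial_hardy_pointwise:
  fixes gu gd :: "'a::real_inner" and s m p Q \<theta> l U \<alpha> :: real
  assumes "s > 0" "p \<ge> 2" "\<alpha> \<ge> 0"
  defines "\<kappa> \<equiv> (Q - p * \<theta>) / p"
  defines "k \<equiv> pw \<bar>\<kappa>\<bar> (p - 2)"
  defines "G \<equiv> s powr (Q - p * \<theta>) * (k * (2 / p * m - \<kappa>))"
    and "G' \<equiv> (Q - p * \<theta>) * s powr (Q - p * \<theta> - 1) * (k * (2 / p * m - \<kappa>))
            + s powr (Q - p * \<theta>) * (k * (2 / p * (- l * s - m\<^sup>2 / s)))"
    and "A \<equiv> (s powr (1 - Q) * pw (norm gd) (\<alpha> + p - 2)) *\<^sub>R gd"
  shows "\<bar>\<kappa>\<bar> powr p * (\<bar>U\<bar> powr p / s powr (p * \<theta>) * norm gd powr (\<alpha> + p))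
      + 2 / p * k * l * (\<bar>U\<bar> powr p / s powr (p * \<theta> - 2) * norm gd powr (\<alpha> + p))
      + (p * (pw \<bar>U\<bar> (p - 2) * U) * (G * (A \<bullet> gu)) + \<bar>U\<bar> powr p * (A \<bullet> (G' *\<^sub>R gd)))
    \<le> \<bar>gu \<bullet> (gd /\<^sub>R norm gd)\<bar> powr p * pw (norm gd) \<alpha> / s powr (p * (\<theta> - 1))"
proof (cases "gd = 0")
  case True
  then show ?thesis using assms(2,3) by (simp add: A_def)
next
  case False
  define r y where "r = norm gd" and "y = (gu \<bullet> gd) / r\<^sup>2"
  have r: "r > 0" using False by (simp add: r_def)
  have rq: "pw r (\<alpha> + p - 2) * r\<^sup>2 = r powr (\<alpha> + p)"
    using r by (simp add: pw_def powr_diff)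
  have Au: "A \<bullet> gu = s powr (1 - Q) * r powr (\<alpha> + p) * y"
    using r by (simp add: A_def r_def[symmetric] rq[symmetric] y_def inner_commute)
  have Ad: "A \<bullet> (G' *\<^sub>R gd) = s powr (1 - Q) * r powr (\<alpha> + p) * G'"
    by (simp add: A_def r_def[symmetric] rq[symmetric] dot_square_norm)
  have "\<bar>gu \<bullet> (gd /\<^sub>R norm gd)\<bar> = \<bar>y\<bar> * r"
    using r by (simp add: y_def r_def[symmetric] abs_mult power2_eq_square field_simps)
  moreover have "pw r \<alpha> = r powr \<alpha>" using r by (simp add: pw_def)
  ultimately have lhs: "\<bar>gu \<bullet> (gd /\<^sub>R norm gd)\<bar> powr p * pw (norm gd) \<alpha> / s powr (p * (\<theta> - 1))
      = r powr (\<alpha> + p) * (\<bar>y\<bar> powr p / s powr (p * (\<theta> - 1)))"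
    using r by (simp add: powr_mult powr_add r_def[symmetric])
  have "r powr (\<alpha> + p) * (\<bar>\<kappa>\<bar> powr p * (\<bar>U\<bar> powr p / s powr (p * \<theta>))
      + 2 / p * k * l * (\<bar>U\<bar> powr p / s powr (p * \<theta> - 2))
      + s powr (1 - Q) * (p * (pw \<bar>U\<bar> (p - 2) * U) * G * y + \<bar>U\<bar> powr p * G'))
    \<le> r powr (\<alpha> + p) * (\<bar>y\<bar> powr p / s powr (p * (\<theta> - 1)))"
    unfolding G_def G'_def k_def \<kappa>_def
    by (intro mult_left_mono radial_profile_bound assms) auto
  then show ?thesis
    unfolding lhs Au Ad by (simp add: r_def[symmetric] algebra_simps)
qed

section \<open>Integration of the pointwise bounds over the support of u\<close>

lemma set_lebesgue_integral_supp:
  fixes f :: "real^'n::finite \<Rightarrow> real"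
  assumes "supp u \<subseteq> B" "\<And>x. x \<notin> supp u \<Longrightarrow> f x = 0"
  shows "set_lebesgue_integral lborel B f = set_lebesgue_integral lborel (supp u) f"
  unfolding set_lebesgue_integral_def
  by (rule Bochner_Integration.integral_cong) (use assms in \<open>auto simp: indicator_def\<close>)

text \<open>Pointwise this is Cauchy-Schwarz against a vector of norm at most 1. For \<alpha> = 0
  the function \<open>I\<close> can be discontinuous where \<open>gradL \<sigma> d\<close> vanishes,
  so its integrability rests on measurability and on the continuous majorant
  \<open>J\<close>.\<close>

lemma radial_gradient_le:
  fixes \<sigma> :: "'h::finite \<Rightarrow> 'n::finite \<Rightarrow> real^'n \<Rightarrow> real" and c :: real
  assumes \<sigma>: "\<And>i j. continuous_on UNIV (\<sigma> i j)"
    and d: "smooth_on (- {0}) d" "\<And>x. x \<noteq> 0 \<Longrightarrow> d x > 0"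
    and u: "test_fun (- {0}) u" and p: "p \<ge> 2" and \<alpha>: "\<alpha> \<ge> 0"
  defines "I \<equiv> \<lambda>x. \<bar>gradL \<sigma> u x \<bullet> (gradL \<sigma> d x /\<^sub>R norm (gradL \<sigma> d x))\<bar> powr p
              * pw (norm (gradL \<sigma> d x)) \<alpha> / d x powr c"
    and "J \<equiv> \<lambda>x. norm (gradL \<sigma> u x) powr p / d x powr c * pw (norm (gradL \<sigma> d x)) \<alpha>"
  shows "set_integrable lborel (supp u) I"
    and "(LINT x:supp u|lborel. I x) \<le> (LINT x:supp u|lborel. J x)"
proof -
  let ?K = "supp u"
  have K: "compact ?K" "?K \<subseteq> - {0}" using u by (auto simp: test_fun_def)
  have su: "smooth_on UNIV u" using u by (simp add: test_fun_def)
  have dpos: "d x > 0" if "x \<in> ?K" for x using that K(2) by (intro d(2)) auto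
  have cd: "continuous_on ?K d"
    using smooth_on_continuous_on[OF d(1)] K(2) by (rule continuous_on_subset)
  have cgd: "continuous_on ?K (gradL \<sigma> d)"
    using continuous_on_gradL[OF \<sigma> d(1)] K(2) by (rule continuous_on_subset)
  have cgu: "continuous_on ?K (gradL \<sigma> u)"
    using continuous_on_gradL[OF \<sigma> su] by (rule continuous_on_subset) simp
  have cw: "continuous_on ?K (\<lambda>x. pw (norm (gradL \<sigma> d x)) \<alpha> / d x powr c)"
    by (intro continuous_on_divide continuous_on_pw continuous_on_norm cgd \<alpha>
        continuous_on_powr continuous_on_const cd) (use dpos in \<open>auto simp: less_le\<close>)
  have cp: "continuous_on ?K (\<lambda>x. norm (gradL \<sigma> u x) powr p)"
    using p by (intro continuous_on_powr' continuous_on_norm cgu continuous_on_const) auto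
  have J: "set_integrable lborel ?K J"
    using continuous_on_mult[OF cp cw]
    by (intro set_integrable_continuous_compact K) (simp add: J_def)
  have le: "I x \<le> J x" "0 \<le> I x" for x
  proof -
    have "\<bar>gradL \<sigma> u x \<bullet> (gradL \<sigma> d x /\<^sub>R norm (gradL \<sigma> d x))\<bar>
        \<le> norm (gradL \<sigma> u x) * norm (gradL \<sigma> d x /\<^sub>R norm (gradL \<sigma> d x))"
      by (rule Cauchy_Schwarz_ineq2)
    also have "\<dots> \<le> norm (gradL \<sigma> u x) * 1"
      by (cases "gradL \<sigma> d x = 0") (auto intro!: mult_left_mono)
    finally have "\<bar>gradL \<sigma> u x \<bullet> (gradL \<sigma> d x /\<^sub>R norm (gradL \<sigma> d x))\<bar> powr p
        \<le> norm (gradL \<sigma> u x) powr p"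
      using p by (intro powr_mono2) auto
    then have "\<bar>gradL \<sigma> u x \<bullet> (gradL \<sigma> d x /\<^sub>R norm (gradL \<sigma> d x))\<bar> powr p
          * (pw (norm (gradL \<sigma> d x)) \<alpha> / d x powr c)
        \<le> norm (gradL \<sigma> u x) powr p * (pw (norm (gradL \<sigma> d x)) \<alpha> / d x powr c)"
      by (rule mult_right_mono) (simp add: pw_def)
    then show "I x \<le> J x" by (simp add: I_def J_def)
    show "0 \<le> I x" by (simp add: I_def pw_def)
  qed
  have "(\<lambda>x. indicator ?K x *\<^sub>R I x) \<in> borel_measurable lborel"
  proof -
    \<comment> \<open>The discontinuity is confined to the quotient a / b of two measurable
      functions; division by 0 yields 0, in agreement with the normalized zero vector in
      \<open>I\<close>.\<close>
    define a b w where "a = (\<lambda>x. indicator ?K x *\<^sub>R (gradL \<sigma> u x \<bullet> gradL \<sigma> d x))"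
      and "b = (\<lambda>x. indicator ?K x *\<^sub>R norm (gradL \<sigma> d x))"
      and "w = (\<lambda>x. indicator ?K x *\<^sub>R (pw (norm (gradL \<sigma> d x)) \<alpha> / d x powr c))"
    have [measurable]: "a \<in> borel_measurable lborel" "b \<in> borel_measurable lborel"
      "w \<in> borel_measurable lborel"
      unfolding a_def b_def w_def
      by (intro borel_measurable_integrable borel_integrable_compact K continuous_on_inner
          continuous_on_norm cgd cgu cw)+
    have "(\<lambda>x. indicator ?K x *\<^sub>R I x) = (\<lambda>x. \<bar>a x / b x\<bar> powr p * w x)"
      by (rule ext) (simp add: a_def b_def w_def I_def divide_inverse mult.commute split: split_indicator)
    then show ?thesis by simp
  qed
  then show "set_integrable lborel ?K I"
    unfolding set_integrable_def
    by (rule Bochner_Integration.integrable_bound[OF J[unfolded set_integrable_def]])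
      (use le order_trans[OF le(2,1)] in \<open>auto split: split_indicator\<close>)
  then show "(LINT x:?K|lborel. I x) \<le> (LINT x:?K|lborel. J x)"
    by (rule set_integral_mono[OF _ J]) (rule le)
qed

text \<open>On the open punctured ball \<open>G (d x)\<close> is smooth, hence an admissible factor
  in \<open>flux_zero_powr\<close>. The error term \<open>F\<close> of the pointwise bound then
  integrates to 0.\<close>

lemma radial_hardy_bessel:
  fixes \<sigma> :: "'h::finite \<Rightarrow> 'n::finite \<Rightarrow> real^'n \<Rightarrow> real"
    and d u :: "real^'n \<Rightarrow> real" and p Q R \<alpha> \<theta> z0 :: real
  assumes \<sigma>: "\<And>i j. continuous_on UNIV (\<sigma> i j)"
    and d_cont: "continuous_on UNIV d"
    and d: "smooth_on (- {0}) d" "\<And>x. d x \<ge> 0" "\<And>x. d x = 0 \<longleftrightarrow> x = 0"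
    and p: "p \<ge> 2" and \<alpha>: "\<alpha> \<ge> 0"
    and harm: "\<alpha> + p \<noteq> Q \<Longrightarrow>
        Lp_harmonic \<sigma> (\<alpha> + p) (\<lambda>x. d x powr ((\<alpha> + p - Q) / (\<alpha> + p - 1))) (- {0})"
      "\<alpha> + p = Q \<Longrightarrow> Lp_harmonic \<sigma> (\<alpha> + p) (\<lambda>x. - ln (d x)) (- {0})"
    and R: "R > 0" and z0: "z0 > 0" "\<And>z. 0 < z \<Longrightarrow> z < z0 \<Longrightarrow> besselJ0 z \<noteq> 0"
    and u: "test_fun ({x. d x < R} - {0}) u"
  defines "\<kappa> \<equiv> (Q - p * \<theta>) / p"
  shows "\<bar>\<kappa>\<bar> powr p * (LINT x:supp u|lborel.
             \<bar>u x\<bar> powr p / d x powr (p * \<theta>) * norm (gradL \<sigma> d x) powr (\<alpha> + p))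
       + 2 / p * pw \<bar>\<kappa>\<bar> (p - 2) * (z0\<^sup>2 / R\<^sup>2) * (LINT x:supp u|lborel.
             \<bar>u x\<bar> powr p / d x powr (p * \<theta> - 2) * norm (gradL \<sigma> d x) powr (\<alpha> + p))
     \<le> (LINT x:supp u|lborel. \<bar>gradL \<sigma> u x \<bullet> (gradL \<sigma> d x /\<^sub>R norm (gradL \<sigma> d x))\<bar> powr p
             * pw (norm (gradL \<sigma> d x)) \<alpha> / d x powr (p * (\<theta> - 1)))"
proof -
  let ?K = "supp u"
  \<comment> \<open>Excludes the origin, where powers of d are singular, and d \<ge> R, where the
    Riccati solution is not under control.\<close>
  define U where "U = {x. d x < R} - {0}"
  define k l where "k = pw \<bar>\<kappa>\<bar> (p - 2)" and "l = z0\<^sup>2 / R\<^sup>2"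
  have dpos: "d x > 0" if "x \<noteq> 0" for x using d(2,3)[of x] that by (simp add: less_le)
  have "{x. d x < R} = d -` {..<R}" by auto
  then have U: "open U"
    unfolding U_def using d_cont open_vimage[of "{..<R}" d] by (auto simp: open_Diff)
  have U0: "U \<subseteq> - {0}" by (auto simp: U_def)
  have dU: "0 < d x" "d x < R" if "x \<in> U" for x using that dpos by (auto simp: U_def)
  have K: "compact ?K" "?K \<subseteq> U" using u by (auto simp: test_fun_def U_def)
  have uU: "test_fun U u" using u by (simp add: U_def)
  have dsU: "smooth_on U d" by (rule smooth_on_subset[OF d(1) U0])
  obtain M where M: "\<And>s. 0 < s \<Longrightarrow> s < R \<Longrightarrow>
      (M has_real_derivative - l * s - (M s)\<^sup>2 / s) (at s)"
    unfolding l_def by (rule bessel_riccati[OF R z0]) auto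
  define G where "G = (\<lambda>s. s powr (Q - p * \<theta>) * (k * (2 / p * M s - \<kappa>)))"
  define G' where "G' = (\<lambda>s. (Q - p * \<theta>) * s powr (Q - p * \<theta> - 1) * (k * (2 / p * M s - \<kappa>))
            + s powr (Q - p * \<theta>) * (k * (2 / p * (- l * s - (M s)\<^sup>2 / s))))"
  have G': "(G has_real_derivative G' (d x)) (at (d x))" if "x \<in> U" for x
    unfolding G_def G'_def using dU[OF that]
    by (auto intro!: derivative_eq_intros M simp: field_simps)
  \<comment> \<open>\<open>M\<close> is known only through its Riccati equation. The right-hand side
    is a polynomial in \<open>M\<close>, d and 1/d, so each order of regularity yields the
    next.\<close>
  have sm: "smooth_on U (\<lambda>x. M (d x))"
  proof (rule smooth_on_compose[OF U dsU])
    show "(M has_real_derivative (- l) * d x + (- 1) * (M (d x) * M (d x) * d x powr - 1)) (at (d x))"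
      if "x \<in> U" for x
      using M[OF dU[OF that]] dU[OF that]
      by (simp add: powr_minus power2_eq_square divide_inverse)
    have "Ck j U (\<lambda>x. d x powr - 1)" for j
      using smooth_on_powr[OF U dsU dU(1)] unfolding smooth_on_def by blast
    then show "Ck j U (\<lambda>x. (- l) * d x + (- 1) * (M (d x) * M (d x) * d x powr - 1))"
      if "Ck j U (\<lambda>x. M (d x))" for j
      using dsU that by (intro Ck_add Ck_mult Ck_const U) (auto simp: smooth_on_def)
  qed
  have sG: "smooth_on U (\<lambda>x. G (d x))"
  proof -
    have "smooth_on U (\<lambda>x. d x powr (Q - p * \<theta>) * (k * (2 / p * M (d x) + - \<kappa>)))"
      by (intro smooth_on_mult smooth_on_add smooth_on_const smooth_on_powr U dsU dU sm)
    then show ?thesis by (simp add: G_def)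
  qed
  \<comment> \<open>The flux field for q = \<alpha> + p: pairing it with
    \<open>gradL \<sigma> d x\<close> produces the weight |grad d|^(\<alpha>+p) of the
    statement.\<close>
  define A where "A = (\<lambda>x. (d x powr (1 - Q) * pw (norm (gradL \<sigma> d x)) (\<alpha> + p - 2)) *\<^sub>R gradL \<sigma> d x)"
  have cd: "continuous_on U d" by (rule smooth_on_continuous_on[OF dsU])
  have cgd: "continuous_on U (gradL \<sigma> d)" by (rule continuous_on_gradL[OF \<sigma> dsU])
  have cA: "continuous_on U A"
    unfolding A_def using p \<alpha>
    by (intro continuous_on_scaleR continuous_on_mult continuous_on_powr continuous_on_pw
        continuous_on_norm continuous_on_const cd cgd) (auto dest: dU)
  have flux: "(\<integral>x. A x \<bullet> gradL \<sigma> \<phi> x \<partial>lborel) = 0" if "test_fun U \<phi>" for \<phi>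
    unfolding A_def
    by (rule radial_flux_zero[OF d(1) dpos _ harm])
      (use that U0 p \<alpha> in \<open>auto simp: test_fun_def\<close>)
  define F where "F = (\<lambda>x. p * (pw \<bar>u x\<bar> (p - 2) * u x) * (G (d x) * (A x \<bullet> gradL \<sigma> u x))
            + \<bar>u x\<bar> powr p * (A x \<bullet> gradL \<sigma> (\<lambda>x. G (d x)) x))"
  have F: "set_integrable lborel ?K F" "(LINT x:?K|lborel. F x) = 0"
    unfolding F_def using flux_zero_powr[OF \<sigma> U cA flux uU sG p] by blast+
  define I1 where "I1 = (\<lambda>x. \<bar>gradL \<sigma> u x \<bullet> (gradL \<sigma> d x /\<^sub>R norm (gradL \<sigma> d x))\<bar> powr p
             * pw (norm (gradL \<sigma> d x)) \<alpha> / d x powr (p * (\<theta> - 1)))"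
  define I where "I = (\<lambda>c x. \<bar>u x\<bar> powr p / d x powr c * norm (gradL \<sigma> d x) powr (\<alpha> + p))"
  have I1: "set_integrable lborel ?K I1"
    unfolding I1_def using u
    by (intro radial_gradient_le[OF \<sigma> d(1) dpos _ p \<alpha>]) (auto simp: test_fun_def)
  have I: "set_integrable lborel ?K (I c)" for c
  proof (rule set_integrable_continuous_compact[OF K(1)])
    have cu: "continuous_on ?K u"
      using u smooth_on_continuous_on[of UNIV u] continuous_on_subset
      by (auto simp: test_fun_def)
    show "continuous_on ?K (I c)"
      unfolding I_def using p \<alpha> dU K(2)
      by (intro continuous_on_mult continuous_on_divide continuous_on_powr[of _ d]
          continuous_on_powr' continuous_on_rabs continuous_on_norm continuous_on_const
          continuous_on_subset[OF cd K(2)] continuous_on_subset[OF cgd K(2)] cu)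
        (auto simp: less_le)
  qed
  have "\<bar>\<kappa>\<bar> powr p * I (p * \<theta>) x + 2 / p * k * l * I (p * \<theta> - 2) x + F x \<le> I1 x"
    if "x \<in> ?K" for x
  proof -
    have x: "x \<in> U" using that K by auto
    have grad: "gradL \<sigma> (\<lambda>x. G (d x)) x = G' (d x) *\<^sub>R gradL \<sigma> d x"
      by (rule gradL_compose[OF smooth_on_has_partial[OF dsU x] G'[OF x]])
    show ?thesis
      unfolding I_def F_def I1_def grad unfolding A_def G_def G'_def k_def \<kappa>_def
      by (rule radial_hardy_pointwise[OF dU(1)[OF x] p \<alpha>])
  qed
  then have "(LINT x:?K|lborel. \<bar>\<kappa>\<bar> powr p * I (p * \<theta>) x + 2 / p * k * l * I (p * \<theta> - 2) x + F x)
      \<le> (LINT x:?K|lborel. I1 x)"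
    by (intro set_integral_mono I1 set_integral_add set_integrable_mult_right I F)
  also have "(LINT x:?K|lborel. \<bar>\<kappa>\<bar> powr p * I (p * \<theta>) x + 2 / p * k * l * I (p * \<theta> - 2) x + F x)
      = \<bar>\<kappa>\<bar> powr p * (LINT x:?K|lborel. I (p * \<theta>) x)
        + 2 / p * k * l * (LINT x:?K|lborel. I (p * \<theta> - 2) x)"
    by (simp add: set_integral_add set_integrable_mult_right I F)
  finally show ?thesis unfolding I_def I1_def k_def l_def .
qed

section \<open>The closed ball as a limit of larger open balls\<close>

theorem mainTheorem5:
  fixes \<sigma> :: "'h::finite \<Rightarrow> 'n::finite \<Rightarrow> real^'n \<Rightarrow> real"
    and \<beta> :: "'n \<Rightarrow> real"
    and d :: "real^'n \<Rightarrow> real"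
    and p \<alpha> \<theta> R z0 :: real
    and u :: "real^'n \<Rightarrow> real"
  assumes h_le_N: "CARD('h) \<le> CARD('n)"
    and sigma_cont: "\<And>i j. continuous_on UNIV (\<sigma> i j)"
    and sigma_partial: "\<And>i j x. has_partial j (\<sigma> i j) x"
    and sigma_partial_cont: "\<And>i j. continuous_on UNIV (partial j (\<sigma> i j))"
    and beta_pos: "\<And>j. \<beta> j > 0"
    and hom: "\<And>c f i x. c > 0 \<Longrightarrow> smooth_on UNIV f \<Longrightarrow>
               Xf \<sigma> i (f \<circ> dil \<beta> c) x = c * Xf \<sigma> i f (dil \<beta> c x)"
    and d_nonneg: "\<And>x. d x \<ge> 0"
    and d_cont: "continuous_on UNIV d"
    and d_smooth: "smooth_on (- {0}) d"
    and d_zero: "\<And>x. d x = 0 \<longleftrightarrow> x = 0"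
    and d_hom: "\<And>c x. c > 0 \<Longrightarrow> d (dil \<beta> c x) = c * d x"
    and d_fund: "\<And>q. q \<ge> 2 \<Longrightarrow>
        (q \<noteq> (\<Sum>j\<in>UNIV. \<beta> j) \<longrightarrow>
           Lp_harmonic \<sigma> q (\<lambda>x. d x powr ((q - (\<Sum>j\<in>UNIV. \<beta> j)) / (q - 1))) (- {0}))
      \<and> (q = (\<Sum>j\<in>UNIV. \<beta> j) \<longrightarrow> Lp_harmonic \<sigma> q (\<lambda>x. - ln (d x)) (- {0}))"
    and p_ge: "p \<ge> 2"
    and alpha_ge: "\<alpha> \<ge> 0"
    and R_pos: "R > 0"
    and z0_pos: "z0 > 0"
    and z0_zero: "besselJ0 z0 = 0"
    and z0_first: "\<And>z. 0 < z \<Longrightarrow> z < z0 \<Longrightarrow> besselJ0 z \<noteq> 0"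
    and u_test: "test_fun ({x. d x \<le> R} - {0}) u"
  shows
    "set_lebesgue_integral lborel {x. d x \<le> R}
        (\<lambda>x. norm (gradL \<sigma> u x) powr p / d x powr (p * (\<theta> - 1)) * pw (norm (gradL \<sigma> d x)) \<alpha>)
     \<ge> set_lebesgue_integral lborel {x. d x \<le> R}
        (\<lambda>x. \<bar>gradL \<sigma> u x \<bullet> (gradL \<sigma> d x /\<^sub>R norm (gradL \<sigma> d x))\<bar> powr p
              * pw (norm (gradL \<sigma> d x)) \<alpha> / d x powr (p * (\<theta> - 1)))
   \<and> set_lebesgue_integral lborel {x. d x \<le> R}
        (\<lambda>x. \<bar>gradL \<sigma> u x \<bullet> (gradL \<sigma> d x /\<^sub>R norm (gradL \<sigma> d x))\<bar> powr p
              * pw (norm (gradL \<sigma> d x)) \<alpha> / d x powr (p * (\<theta> - 1)))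
     \<ge> \<bar>((\<Sum>j\<in>UNIV. \<beta> j) - p * \<theta>) / p\<bar> powr p
         * set_lebesgue_integral lborel {x. d x \<le> R}
             (\<lambda>x. \<bar>u x\<bar> powr p / d x powr (p * \<theta>) * norm (gradL \<sigma> d x) powr (\<alpha> + p))
       + 2 / p * pw \<bar>((\<Sum>j\<in>UNIV. \<beta> j) - p * \<theta>) / p\<bar> (p - 2) * z0\<^sup>2 / R\<^sup>2
         * set_lebesgue_integral lborel {x. d x \<le> R}
             (\<lambda>x. \<bar>u x\<bar> powr p / d x powr (p * \<theta> - 2) * norm (gradL \<sigma> d x) powr (\<alpha> + p))"
proof -
  define Q where "Q = (\<Sum>j\<in>UNIV. \<beta> j)"
  let ?B = "{x. d x \<le> R}"
  have dpos: "d x > 0" if "x \<noteq> 0" for x using d_nonneg[of x] d_zero[of x] that by (simp add: less_le)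
  have sub: "supp u \<subseteq> ?B" using u_test by (auto simp: test_fun_def)
  have u0: "test_fun (- {0}) u" using u_test by (auto simp: test_fun_def)
  define I0 where "I0 = (\<lambda>x. norm (gradL \<sigma> u x) powr p / d x powr (p * (\<theta> - 1))
      * pw (norm (gradL \<sigma> d x)) \<alpha>)"
  define I1 where "I1 = (\<lambda>x. \<bar>gradL \<sigma> u x \<bullet> (gradL \<sigma> d x /\<^sub>R norm (gradL \<sigma> d x))\<bar> powr p
      * pw (norm (gradL \<sigma> d x)) \<alpha> / d x powr (p * (\<theta> - 1)))"
  define I where "I = (\<lambda>c x. \<bar>u x\<bar> powr p / d x powr c * norm (gradL \<sigma> d x) powr (\<alpha> + p))"
  have I: "(\<lambda>x. \<bar>u x\<bar> powr p / d x powr c * norm (gradL \<sigma> d x) powr (\<alpha> + p)) = I c" for c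
    by (simp add: I_def)
  \<comment> \<open>Every integrand contains a positive power of u or of its gradient and so
    vanishes off the support; the domain of integration thus becomes independent of the
    radius.\<close>
  have B: "set_lebesgue_integral lborel ?B I0 = set_lebesgue_integral lborel (supp u) I0"
    "set_lebesgue_integral lborel ?B I1 = set_lebesgue_integral lborel (supp u) I1"
    "set_lebesgue_integral lborel ?B (I c) = set_lebesgue_integral lborel (supp u) (I c)" for c
    using sub by (auto intro!: set_lebesgue_integral_supp
        simp: I0_def I1_def I_def gradL_notin_supp eq_zero_notin_supp)
  define a b where "a = \<bar>(Q - p * \<theta>) / p\<bar> powr p * set_lebesgue_integral lborel (supp u) (I (p * \<theta>))"
    and "b = 2 / p * pw \<bar>(Q - p * \<theta>) / p\<bar> (p - 2) * z0\<^sup>2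
      * set_lebesgue_integral lborel (supp u) (I (p * \<theta> - 2))"
  have "a + b / R\<^sup>2 \<le> set_lebesgue_integral lborel (supp u) I1"
  proof (rule add_divide_square_le_limit[OF R_pos])
    fix R' assume R': "R' > R"
    have "test_fun ({x. d x < R'} - {0}) u" using u_test R' by (force simp: test_fun_def)
    then have "\<bar>(Q - p * \<theta>) / p\<bar> powr p * set_lebesgue_integral lborel (supp u) (I (p * \<theta>))
       + 2 / p * pw \<bar>(Q - p * \<theta>) / p\<bar> (p - 2) * (z0\<^sup>2 / R'\<^sup>2)
         * set_lebesgue_integral lborel (supp u) (I (p * \<theta> - 2))
       \<le> set_lebesgue_integral lborel (supp u) I1"
      unfolding I_def I1_def using d_fund[of "\<alpha> + p"] p_ge alpha_ge R' R_pos
      by (intro radial_hardy_bessel sigma_cont d_cont d_smooth d_nonneg d_zero z0_pos z0_first)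
        (auto simp: Q_def)
    then show "a + b / R'\<^sup>2 \<le> set_lebesgue_integral lborel (supp u) I1"
      by (simp add: a_def b_def)
  qed
  moreover have "set_lebesgue_integral lborel (supp u) I1 \<le> set_lebesgue_integral lborel (supp u) I0"
    unfolding I1_def I0_def
    by (rule radial_gradient_le(2)[OF sigma_cont d_smooth dpos u0 p_ge alpha_ge])
  ultimately show ?thesis
    unfolding I0_def[symmetric] I1_def[symmetric] I B Q_def[symmetric]
    by (simp add: a_def b_def)
qed

end
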